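(* Let $H$ be a monotone integer priority queue such that Dijkstra's algorithm, when it uses $H$ with the integer tentative distances $D(v)$ as keys on instances of integer P-SSSP, processes the nodes in a full ordering (i.e., if $v_1,\dots,v_n$ is the processing order then $i<j \Rightarrow d(v_i)\le d(v_j)$). Consider an instance of floating point P-SSSP with minimum edge length $\delta>0$. Run Dijkstra's algorithm using $H$ as follows: whenever the floating point tentative distance $D(u)$ of a node $u$ is set or decreased, its integer key $\hat D(u)=\lfloor D(u)/\delta\rfloor$ (conversion to an integer with truncation) is recomputed and $u$'s position in $H$ is updated using $\hat D(u)$; the next node to be processed is the one extracted from $H$. Then the resulting processing order $v_1,\dots,v_n$ is a $\delta$-PO, i.e., for all $i<j$, $d(v_i)<d(v_j)+\delta$.
   Context: A graph $G=(V,E)$ has finitely many nodes $n=|V|$ and edges $m=|E|$, edges directed (or undirected), each edge $\varepsilon$ having a length $\ell(\varepsilon)$. A source node $s\in V$ is given and $d(v)$ denotes the length of a shortest path from $s$ to $v$. SSSP asks for $d(v)$ for all $v$ together with a shortest-path tree (parent pointers). P-SSSP is the case where all edge lengths satisfy $0<\delta\le \ell(\varepsilon)$, where $\delta=\min_{\varepsilon\in E}\ell(\varepsilon)$; "integer" or "floating point" refers to the type of the edge weights. Dijkstra's algorithm: initialize $D(v)=\infty$ for all $v$, $D(s)=0$; repeatedly "process" a not-yet-processed node $v$ (the first is $s$): set $d(v)$ to $D(v)$ and, for each out-neighbor $u$ with $D(v)+\ell(v,u)<D(u)$, set $D(u)=D(v)+\ell(v,u)$ and the parent of $u$ to $v$,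 updating the priority queue. The processing order is denoted $v_1,\dots,v_n$. A monotone integer priority queue stores nodes with integer keys, supports insertion/decrease-key, and its extract-min operation returns a node of minimum key, so that the extracted keys form a nondecreasing sequence. *)

theory Defs
  imports Complex_Main "Graph_Theory.Shortest_Path" "Graph_Theory.Pair_Digraph"
begin

section \<open>Instances\<close>

text \<open>
  Edges are pairs of nodes; an undirected graph is the digraph whose edge set and length function
  are symmetric. Since \<open>\<delta>\<close> is the minimum edge length, an instance has at least one edge. The type
  \<open>'w\<close> of edge lengths is \<open>int\<close> for integer instances and \<open>real\<close> for floating point ones.
\<close>

definition P_SSSP ::
  "'v pair_pre_digraph \<Rightarrow> ('v \<times> 'v \<Rightarrow> 'w::linordered_idom) \<Rightarrow> 'v \<Rightarrow> 'w \<Rightarrow> bool" where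
  "P_SSSP G len s \<delta> \<longleftrightarrow>
     pair_fin_digraph G \<and> s \<in> pverts G \<and> parcs G \<noteq> {} \<and> \<delta> = Min (len ` parcs G) \<and> 0 < \<delta>"

text \<open>The distance is \<open>\<infinity>\<close> at nodes that are not reachable from \<open>s\<close>.\<close>

definition sp_dist :: "'v pair_pre_digraph \<Rightarrow> ('v \<times> 'v \<Rightarrow> real) \<Rightarrow> 'v \<Rightarrow> 'v \<Rightarrow> ereal" where
  "sp_dist G len s v = wf_digraph.\<mu> (with_proj G) len s v"

section \<open>Orders\<close>

definition full_order :: "('v \<Rightarrow> ereal) \<Rightarrow> 'v list \<Rightarrow> bool" where
  "full_order d vs \<longleftrightarrow> (\<forall>i j. i < j \<and> j < length vs \<longrightarrow> d (vs ! i) \<le> d (vs ! j))"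

definition delta_PO :: "real \<Rightarrow> ('v \<Rightarrow> ereal) \<Rightarrow> 'v list \<Rightarrow> bool" where
  "delta_PO \<delta> d vs \<longleftrightarrow> (\<forall>i j. i < j \<and> j < length vs \<longrightarrow> d (vs ! i) < d (vs ! j) + ereal \<delta>)"

section \<open>Monotone integer priority queues\<close>

text \<open>An implementation with internal states of type \<open>'h\<close>.\<close>

record ('v, 'h) int_pq =
  pq_empty :: 'h
  pq_insert :: "'v \<Rightarrow> int \<Rightarrow> 'h \<Rightarrow> 'h"
  pq_decrease_key :: "'v \<Rightarrow> int \<Rightarrow> 'h \<Rightarrow> 'h"
  pq_extract_min :: "'h \<Rightarrow> ('v \<times> 'h) option"

text \<open>
  \<open>pq_state H h M l\<close>: some monotone sequence of operations leads from the empty queue to the internal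
  state \<open>h\<close>, after which the queue should contain exactly the nodes in \<open>dom M\<close>, with the keys given
  by \<open>M\<close>, and \<open>l\<close> is the key extracted last (0 if there was no extraction). Monotone means that keys
  below \<open>l\<close> are never supplied. Nothing is required of \<open>H\<close> outside of such sequences; within them, the
  extracted keys form a nondecreasing sequence.
\<close>

inductive pq_state :: "('v, 'h) int_pq \<Rightarrow> 'h \<Rightarrow> ('v \<rightharpoonup> int) \<Rightarrow> int \<Rightarrow> bool"
  for H :: "('v, 'h) int_pq" where
  empty: "pq_state H (pq_empty H) Map.empty 0"
| insert: "\<lbrakk> pq_state H h M l; v \<notin> dom M; l \<le> k \<rbrakk>
    \<Longrightarrow> pq_state H (pq_insert H v k h) (M(v \<mapsto> k)) l"
| decrease_key: "\<lbrakk> pq_state H h M l; M v = Some k'; l \<le> k; k \<le> k' \<rbrakk>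
    \<Longrightarrow> pq_state H (pq_decrease_key H v k h) (M(v \<mapsto> k)) l"
| extract_min: "\<lbrakk> pq_state H h M l; pq_extract_min H h = Some (v, h'); M v = Some k \<rbrakk>
    \<Longrightarrow> pq_state H h' (M(v := None)) k"

definition monotone_int_pq :: "('v, 'h) int_pq \<Rightarrow> bool" where
  "monotone_int_pq H \<longleftrightarrow>
     (\<forall>h M l. pq_state H h M l \<longrightarrow>
        (case pq_extract_min H h of
           None \<Rightarrow> M = Map.empty
         | Some (v, h') \<Rightarrow> v \<in> dom M \<and> (\<forall>u \<in> dom M. the (M v) \<le> the (M u))))"

section \<open>Dijkstra's algorithm\<close>

text \<open>
  In \<open>tent\<close> (the tentative distances \<open>D\<close>) the value \<open>None\<close> stands for \<open>\<infinity>\<close>. The field \<open>label\<close> holds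
  the values \<open>d(v)\<close> of the nodes that have been processed, and \<open>order\<close> lists these nodes in the order
  of their processing.
\<close>

record ('v, 'w, 'h) dijkstra_state =
  tent :: "'v \<rightharpoonup> 'w"
  label :: "'v \<rightharpoonup> 'w"
  parent :: "'v \<rightharpoonup> 'v"
  queue :: 'h
  order :: "'v list"

text \<open>
  The function \<open>key\<close> converts a finite tentative distance into the integer key under which a node is
  stored. Nodes of infinite tentative distance are not in the queue.
\<close>

definition set_tent ::
  "('v, 'h) int_pq \<Rightarrow> ('w \<Rightarrow> int) \<Rightarrow> 'v \<Rightarrow> 'w
   \<Rightarrow> ('v, 'w, 'h) dijkstra_state \<Rightarrow> ('v, 'w, 'h) dijkstra_state" where
  "set_tent H key u x \<sigma> = \<sigma>\<lparr>
     tent := (tent \<sigma>)(u \<mapsto> x),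
     queue := (case tent \<sigma> u of
                 None \<Rightarrow> pq_insert H u (key x) (queue \<sigma>)
               | Some _ \<Rightarrow> pq_decrease_key H u (key x) (queue \<sigma>))\<rparr>"

definition dijkstra_init ::
  "('v, 'h) int_pq \<Rightarrow> ('w::linordered_idom \<Rightarrow> int) \<Rightarrow> 'v \<Rightarrow> ('v, 'w, 'h) dijkstra_state" where
  "dijkstra_init H key s = set_tent H key s 0
     \<lparr>tent = Map.empty, label = Map.empty, parent = Map.empty, queue = pq_empty H, order = []\<rparr>"

text \<open>Relaxation of the edge \<open>(v, u)\<close>, where \<open>x\<close> is the distance of \<open>v\<close>.\<close>

definition relax ::
  "('v, 'h) int_pq \<Rightarrow> ('w::linordered_idom \<Rightarrow> int) \<Rightarrow> ('v \<times> 'v \<Rightarrow> 'w) \<Rightarrow> 'v \<Rightarrow> 'w \<Rightarrow> 'v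
   \<Rightarrow> ('v, 'w, 'h) dijkstra_state \<Rightarrow> ('v, 'w, 'h) dijkstra_state" where
  "relax H key len v x u \<sigma> =
     (if (case tent \<sigma> u of None \<Rightarrow> True | Some y \<Rightarrow> x + len (v, u) < y)
      then (set_tent H key u (x + len (v, u)) \<sigma>)\<lparr>parent := (parent \<sigma>)(u \<mapsto> v)\<rparr>
      else \<sigma>)"

text \<open>The out-neighbours may be scanned in any order \<open>us\<close>.\<close>

inductive dijkstra_reach ::
  "('v, 'h) int_pq \<Rightarrow> ('w::linordered_idom \<Rightarrow> int) \<Rightarrow> 'v pair_pre_digraph \<Rightarrow> ('v \<times> 'v \<Rightarrow> 'w) \<Rightarrow> 'v
   \<Rightarrow> ('v, 'w, 'h) dijkstra_state \<Rightarrow> bool"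
  for H :: "('v, 'h) int_pq" and key :: "'w::linordered_idom \<Rightarrow> int" and G len s where
  init: "dijkstra_reach H key G len s (dijkstra_init H key s)"
| process: "\<lbrakk> dijkstra_reach H key G len s \<sigma>; pq_extract_min H (queue \<sigma>) = Some (v, h');
      tent \<sigma> v = Some x; distinct us; set us = {u. (v, u) \<in> parcs G} \<rbrakk>
    \<Longrightarrow> dijkstra_reach H key G len s
          (fold (relax H key len v x) us
            (\<sigma>\<lparr>queue := h', label := (label \<sigma>)(v \<mapsto> x), order := order \<sigma> @ [v]\<rparr>))"

text \<open>The outcome of a complete run, which ends when the queue is exhausted.\<close>

definition dijkstra_result ::
  "('v, 'h) int_pq \<Rightarrow> ('w::linordered_idom \<Rightarrow> int) \<Rightarrow> 'v pair_pre_digraph \<Rightarrow> ('v \<times> 'v \<Rightarrow> 'w) \<Rightarrow> 'v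
   \<Rightarrow> ('v, 'w, 'h) dijkstra_state \<Rightarrow> bool" where
  "dijkstra_result H key G len s \<sigma> \<longleftrightarrow>
     dijkstra_reach H key G len s \<sigma> \<and> pq_extract_min H (queue \<sigma>) = None"

definition label_dist :: "('v, real, 'h) dijkstra_state \<Rightarrow> 'v \<Rightarrow> ereal" where
  "label_dist \<sigma> v = (case label \<sigma> v of None \<Rightarrow> \<infinity> | Some x \<Rightarrow> ereal x)"

end

theory Submission
  imports Defs
begin

text \<open>
  Relaxing an edge out of a node of tentative distance \<open>x\<close> yields a value of at least \<open>x + \<delta>\<close>, whose
  truncated key exceeds that of \<open>x\<close>. So keys below the last extracted one are never supplied, the
  nodes are extracted in nondecreasing order of their keys, and a processed node is never relaxed
  again. Hence Dijkstra's algorithm is label-setting in spite of the truncation, and its labels are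
  the exact distances. Nodes with \<open>\<lfloor>d(v\<^sub>i) / \<delta>\<rfloor> \<le> \<lfloor>d(v\<^sub>j) / \<delta>\<rfloor>\<close> satisfy \<open>d(v\<^sub>i) < d(v\<^sub>j) + \<delta>\<close>.
\<close>

section \<open>Keys in a monotone priority queue\<close>

lemma monotone_int_pq_extract_min:
  assumes "monotone_int_pq H" "pq_state H h M l" "pq_extract_min H h = Some (v, h')"
  obtains k where "M v = Some k" "\<And>u k'. M u = Some k' \<Longrightarrow> k \<le> k'"
proof -
  have "v \<in> dom M \<and> (\<forall>u \<in> dom M. the (M v) \<le> the (M u))"
    using assms(1)[unfolded monotone_int_pq_def, rule_format, OF assms(2)] assms(3) by simp
  then show ?thesis using that by force
qed

text \<open>Only an extraction changes \<open>l\<close>, and it sets \<open>l\<close> to the minimum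
  of the stored keys; insertions and key decreases are guarded by \<open>l \<le> k\<close>.\<close>

lemma pq_state_key_ge:
  assumes "monotone_int_pq H"
  shows "pq_state H h M l \<Longrightarrow> M u = Some k \<Longrightarrow> l \<le> k"
proof (induction arbitrary: u k rule: pq_state.induct)
  case (extract_min h M l v h' k')
  then show ?case
    using monotone_int_pq_extract_min[OF assms extract_min.hyps(1,2)]
    by (metis fun_upd_apply option.discI option.inject)
qed (auto split: if_splits)

section \<open>The invariant of Dijkstra's algorithm under integer keys\<close>

lemma fold_relax_order [simp]: "order (fold (relax H key len v x) us \<sigma>) = order \<sigma>"
  by (induction us arbitrary: \<sigma>) (auto simp: relax_def set_tent_def)

text \<open>The abstract queue content, for use as \<open>M\<close> in \<open>pq_state\<close>.
  Processed nodes keep their tentative distance after leaving the queue, so they have to be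
  masked.\<close>

definition queued_keys ::
  "('w \<Rightarrow> int) \<Rightarrow> ('v, 'w, 'h) dijkstra_state \<Rightarrow> ('v \<rightharpoonup> int)" where
  "queued_keys key \<sigma> v = (if v \<in> set (order \<sigma>) then None else map_option key (tent \<sigma> v))"

text \<open>Properties of truncation that suffice for a label-setting run. \<open>key_0\<close>
  permits the insertion of \<open>s\<close>, since \<open>l\<close> starts at 0;
  \<open>key_less\<close> and \<open>mono_key\<close> together force positive edge lengths.\<close>

locale keyed_dijkstra = pair_fin_digraph G
  for G :: "'v pair_pre_digraph" +
  fixes H :: "('v, 'h) int_pq" and key :: "real \<Rightarrow> int"
    and len :: "'v \<times> 'v \<Rightarrow> real" and s :: 'v
  assumes pq: "monotone_int_pq H"
    and mono_key: "mono key"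
    and key_0: "0 \<le> key 0"
    and key_less: "e \<in> parcs G \<Longrightarrow> key x < key (x + len e)"
    and source: "s \<in> pverts G"
begin

text \<open>\<open>E\<close> is the set of the edges relaxed so far, and \<open>l\<close> is the key extracted last.\<close>

definition dijkstra_inv :: "('v \<times> 'v) set \<Rightarrow> int \<Rightarrow> ('v, real, 'h) dijkstra_state \<Rightarrow> bool" where
  "dijkstra_inv E l \<sigma> \<longleftrightarrow>
     pq_state H (queue \<sigma>) (queued_keys key \<sigma>) l \<and>
     (\<forall>w \<in> set (order \<sigma>). \<exists>y. tent \<sigma> w = Some y \<and> label \<sigma> w = Some y \<and> key y \<le> l) \<and>
     sorted_wrt (\<lambda>v w. key (the (tent \<sigma> v)) \<le> key (the (tent \<sigma> w))) (order \<sigma>) \<and>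
     (\<forall>(w, u) \<in> E. w \<in> set (order \<sigma>) \<and>
        (\<exists>y. tent \<sigma> u = Some y \<and> y \<le> the (tent \<sigma> w) + len (w, u))) \<and>
     (\<exists>y. tent \<sigma> s = Some y \<and> y \<le> 0) \<and>
     (\<forall>u y. tent \<sigma> u = Some y \<longrightarrow> (\<exists>p. awalk s p u \<and> awalk_cost len p = y))"

lemma dijkstra_inv_init: "dijkstra_inv {} 0 (dijkstra_init H key s)"
proof -
  have "pq_state H (pq_insert H s (key 0) (pq_empty H)) (Map.empty(s \<mapsto> key 0)) 0"
    by (rule pq_state.insert) (auto intro: pq_state.empty key_0)
  moreover have "queued_keys key (dijkstra_init H key s) = Map.empty(s \<mapsto> key 0)"
    by (auto simp: queued_keys_def dijkstra_init_def set_tent_def)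
  moreover have "awalk s [] s"
    using source by (simp add: awalk_Nil_iff)
  ultimately show ?thesis
    unfolding dijkstra_inv_def by (auto simp: dijkstra_init_def set_tent_def intro!: exI[of _ "[]"])
qed

text \<open>The key extracted last is that of \<open>v\<close>. An update gives \<open>u\<close> a
  strictly larger key, so the queue operation is monotone; it can only affect an unprocessed node,
  so labels and sortedness persist.\<close>

lemma dijkstra_inv_relax:
  assumes inv: "dijkstra_inv E (key x) \<sigma>"
    and v: "v \<in> set (order \<sigma>)" "tent \<sigma> v = Some x" and vu: "(v, u) \<in> parcs G"
  shows "dijkstra_inv (insert (v, u) E) (key x) (relax H key len v x u \<sigma>)"
proof (cases "\<exists>y. tent \<sigma> u = Some y \<and> y \<le> x + len (v, u)")
  case True
  then have "relax H key len v x u \<sigma> = \<sigma>"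
    by (auto simp: relax_def)
  then show ?thesis
    using inv v True by (auto simp: dijkstra_inv_def)
next
  case False
  define x' where "x' = x + len (v, u)"
  define \<sigma>' where "\<sigma>' = relax H key len v x u \<sigma>"
  have less: "x' < y" if "tent \<sigma> u = Some y" for y
    using False that by (force simp: x'_def)
  have \<sigma>': "\<sigma>' = (set_tent H key u x' \<sigma>)\<lparr>parent := (parent \<sigma>)(u \<mapsto> v)\<rparr>"
    using less by (auto simp: \<sigma>'_def relax_def x'_def split: option.splits)
  then have sel: "tent \<sigma>' = (tent \<sigma>)(u \<mapsto> x')" "label \<sigma>' = label \<sigma>" "order \<sigma>' = order \<sigma>"
    by (simp_all add: set_tent_def)
  have key_x': "key x < key x'"
    using key_less[OF vu] by (simp add: x'_def)
  \<comment> \<open>If \<open>u\<close> were processed, possibly with \<open>u = v\<close>, then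
    \<open>x' < y\<close> would give \<open>key x' \<le> key y \<le> key x\<close>.\<close>
  have u: "u \<notin> set (order \<sigma>)"
  proof
    assume "u \<in> set (order \<sigma>)"
    then obtain y where "tent \<sigma> u = Some y" "key y \<le> key x"
      using inv unfolding dijkstra_inv_def by blast
    then show False
      using less monoD[OF mono_key, of x' y] key_x' by fastforce
  qed
  have keys': "queued_keys key \<sigma>' = (queued_keys key \<sigma>)(u \<mapsto> key x')"
    using u by (auto simp: queued_keys_def sel)
  have state: "pq_state H (queue \<sigma>) (queued_keys key \<sigma>) (key x)"
    using inv by (simp add: dijkstra_inv_def)
  have "pq_state H (queue \<sigma>') (queued_keys key \<sigma>') (key x)"
  proof (cases "tent \<sigma> u")
    case None
    then have "queue \<sigma>' = pq_insert H u (key x') (queue \<sigma>)" "u \<notin> dom (queued_keys key \<sigma>)"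
      by (auto simp: \<sigma>' set_tent_def queued_keys_def domIff)
    then show ?thesis
      using pq_state.insert[OF state, of u "key x'"] key_x' by (simp add: keys')
  next
    case (Some y)
    then have "queue \<sigma>' = pq_decrease_key H u (key x') (queue \<sigma>)"
        "queued_keys key \<sigma> u = Some (key y)"
      using u by (auto simp: \<sigma>' set_tent_def queued_keys_def)
    then show ?thesis
      using pq_state.decrease_key[OF state, of u "key y" "key x'"] key_x' less[OF Some]
        monoD[OF mono_key, of x' y] by (simp add: keys')
  qed
  moreover have "sorted_wrt (\<lambda>v w. key (the (tent \<sigma>' v)) \<le> key (the (tent \<sigma>' w))) (order \<sigma>')"
  proof -
    have "sorted_wrt (\<lambda>v w. key (the (tent \<sigma> v)) \<le> key (the (tent \<sigma> w))) (order \<sigma>)"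
      using inv by (simp add: dijkstra_inv_def)
    then show ?thesis
      unfolding sel by (rule sorted_wrt_mono_rel[rotated]) (use u in auto)
  qed
  moreover have "w \<in> set (order \<sigma>') \<and>
      (\<exists>y. tent \<sigma>' t = Some y \<and> y \<le> the (tent \<sigma>' w) + len (w, t))"
    if "(w, t) \<in> insert (v, u) E" for w t
  proof (cases "(w, t) = (v, u)")
    case True
    then show ?thesis using v u by (auto simp: sel x'_def)
  next
    case False
    then have "(w, t) \<in> E"
      using that by auto
    moreover have "\<forall>(w, t) \<in> E. w \<in> set (order \<sigma>) \<and>
        (\<exists>y. tent \<sigma> t = Some y \<and> y \<le> the (tent \<sigma> w) + len (w, t))"
      using inv by (simp add: dijkstra_inv_def)
    ultimately obtain y where y: "w \<in> set (order \<sigma>)" "tent \<sigma> t = Some y"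
        "y \<le> the (tent \<sigma> w) + len (w, t)"
      by auto
    \<comment> \<open>Since \<open>w\<close> is processed and \<open>u\<close> is not, the
      right-hand side of the edge inequality is unchanged, while the value at \<open>t\<close> can
      only drop.\<close>
    moreover have "w \<noteq> u"
      using y(1) u by auto
    ultimately show ?thesis
      using less[of y] by (auto simp: sel)
  qed
  moreover have "\<exists>y. tent \<sigma>' s = Some y \<and> y \<le> 0"
  proof -
    obtain y where "tent \<sigma> s = Some y" "y \<le> 0"
      using inv unfolding dijkstra_inv_def by blast
    then show ?thesis using less[of y] by (auto simp: sel)
  qed
  moreover have "\<exists>p. awalk s p t \<and> awalk_cost len p = y" if "tent \<sigma>' t = Some y" for t y
  proof (cases "t = u")
    case True
    obtain p where p: "awalk s p v" "awalk_cost len p = x"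
      using inv v unfolding dijkstra_inv_def by blast
    have "awalk v [(v, u)] u"
      using arc_implies_awalk[of "(v, u)"] vu by simp
    then have "awalk s (p @ [(v, u)]) u"
      using p by (blast intro: awalk_appendI)
    then show ?thesis
      using p True that by (auto simp: sel x'_def intro!: exI[of _ "p @ [(v, u)]"])
  next
    case False
    then show ?thesis using inv that by (auto simp: dijkstra_inv_def sel)
  qed
  moreover have "\<forall>w \<in> set (order \<sigma>'). \<exists>y. tent \<sigma>' w = Some y \<and> label \<sigma>' w = Some y \<and> key y \<le> key x"
    using inv u unfolding dijkstra_inv_def sel by fastforce
  ultimately show ?thesis
    unfolding dijkstra_inv_def \<sigma>'_def by blast
qed

text \<open>Guards against a self-loop at \<open>v\<close>: an update would need
  \<open>x + len (v, v) < x\<close>. Thus the whole scan of out-neighbours can use the same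
  \<open>x\<close>.\<close>

lemma relax_tent_processed:
  assumes "dijkstra_inv E (key x) \<sigma>" "v \<in> set (order \<sigma>)" "tent \<sigma> v = Some x" "(v, u) \<in> parcs G"
  shows "tent (relax H key len v x u \<sigma>) v = Some x"
  using assms(3) key_less[OF assms(4), of x] monoD[OF mono_key, of "x + len (v, u)" x]
  by (auto simp: relax_def set_tent_def)

lemma dijkstra_inv_fold_relax:
  assumes "dijkstra_inv E (key x) \<sigma>" "v \<in> set (order \<sigma>)" "tent \<sigma> v = Some x"
    and "\<forall>u \<in> set us. (v, u) \<in> parcs G"
  shows "dijkstra_inv (E \<union> Pair v ` set us) (key x) (fold (relax H key len v x) us \<sigma>)"
  using assms
proof (induction us arbitrary: E \<sigma>)
  case (Cons u us)
  have "order (relax H key len v x u \<sigma>) = order \<sigma>"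
    using fold_relax_order[of H key len v x "[u]"] by simp
  then show ?case
    using Cons.IH[OF dijkstra_inv_relax[OF Cons.prems(1-3)]] relax_tent_processed[OF Cons.prems(1-3)]
      Cons.prems by simp
qed simp

text \<open>Each processing step scans all out-edges of the new node, so between steps the relaxed
  edges are exactly those leaving processed nodes. The state does not record \<open>l\<close>, hence
  the existential.\<close>

lemma dijkstra_reach_inv:
  assumes "dijkstra_reach H key G len s \<sigma>"
  shows "\<exists>l. dijkstra_inv {e \<in> parcs G. fst e \<in> set (order \<sigma>)} l \<sigma>"
  using assms
proof (induction rule: dijkstra_reach.induct)
  case init
  have "order (dijkstra_init H key s) = []"
    by (simp add: dijkstra_init_def set_tent_def)
  then show ?case using dijkstra_inv_init by auto
next
  case (process \<sigma> v h' x us)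
  define E where "E = {e \<in> parcs G. fst e \<in> set (order \<sigma>)}"
  define \<sigma>\<^sub>1 where "\<sigma>\<^sub>1 = \<sigma>\<lparr>queue := h', label := (label \<sigma>)(v \<mapsto> x), order := order \<sigma> @ [v]\<rparr>"
  obtain l where inv: "dijkstra_inv E l \<sigma>"
    using process.IH by (auto simp: E_def)
  then have state: "pq_state H (queue \<sigma>) (queued_keys key \<sigma>) l"
    by (simp add: dijkstra_inv_def)
  \<comment> \<open>The extracted node lies in the domain of \<open>queued_keys\<close>, which
    excludes a second processing of the same node.\<close>
  obtain k where "queued_keys key \<sigma> v = Some k"
    using monotone_int_pq_extract_min[OF pq state process.hyps(2)] .
  then have v: "v \<notin> set (order \<sigma>)" "queued_keys key \<sigma> v = Some (key x)"
    using process.hyps(3) by (auto simp: queued_keys_def split: if_splits)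
  have "l \<le> key x"
    using pq_state_key_ge[OF pq state v(2)] .
  have "queued_keys key \<sigma>\<^sub>1 = (queued_keys key \<sigma>)(v := None)"
    by (auto simp: queued_keys_def \<sigma>\<^sub>1_def)
  then have "pq_state H (queue \<sigma>\<^sub>1) (queued_keys key \<sigma>\<^sub>1) (key x)"
    using pq_state.extract_min[OF state process.hyps(2) v(2)] by (simp add: \<sigma>\<^sub>1_def)
  moreover have "\<exists>y. tent \<sigma>\<^sub>1 w = Some y \<and> label \<sigma>\<^sub>1 w = Some y \<and> key y \<le> key x"
    if "w \<in> set (order \<sigma>\<^sub>1)" for w
  proof (cases "w = v")
    case False
    then have "w \<in> set (order \<sigma>)"
      using that by (simp add: \<sigma>\<^sub>1_def)
    then obtain y where "tent \<sigma> w = Some y" "label \<sigma> w = Some y" "key y \<le> l"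
      using inv unfolding dijkstra_inv_def by blast
    then show ?thesis
      using \<open>l \<le> key x\<close> False by (simp add: \<sigma>\<^sub>1_def)
  qed (simp add: \<sigma>\<^sub>1_def process.hyps(3))
  \<comment> \<open>By the bound just shown, all earlier keys are at most \<open>key x\<close>, so
    \<open>v\<close> may be appended.\<close>
  moreover from this have
    "sorted_wrt (\<lambda>v w. key (the (tent \<sigma>\<^sub>1 v)) \<le> key (the (tent \<sigma>\<^sub>1 w))) (order \<sigma>\<^sub>1)"
    using inv process.hyps(3) by (fastforce simp: dijkstra_inv_def \<sigma>\<^sub>1_def sorted_wrt_append)
  ultimately have "dijkstra_inv E (key x) \<sigma>\<^sub>1"
    using inv unfolding dijkstra_inv_def by (auto simp: \<sigma>\<^sub>1_def)
  then have "dijkstra_inv (E \<union> Pair v ` set us) (key x) (fold (relax H key len v x) us \<sigma>\<^sub>1)"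
    by (rule dijkstra_inv_fold_relax) (use process.hyps in \<open>auto simp: \<sigma>\<^sub>1_def\<close>)
  moreover have "E \<union> Pair v ` set us = {e \<in> parcs G. fst e \<in> set (order \<sigma>\<^sub>1)}"
    using process.hyps(5) by (auto simp: E_def \<sigma>\<^sub>1_def)
  ultimately show ?case
    unfolding \<sigma>\<^sub>1_def by auto
qed

section \<open>Exactness of the final distances\<close>

text \<open>At termination every edge out of a reached node has been relaxed. The tentative
  distances then bound all walk costs from \<open>s\<close> from below, and the invariant supplies a
  walk attaining each of them.\<close>

lemma dijkstra_result_sp_dist:
  assumes "dijkstra_result H key G len s \<sigma>" "w \<in> set (order \<sigma>)"
  shows "sp_dist G len s w = ereal (the (tent \<sigma> w))"
proof -
  obtain l where inv: "dijkstra_inv {e \<in> parcs G. fst e \<in> set (order \<sigma>)} l \<sigma>"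
    using assms(1) dijkstra_reach_inv by (auto simp: dijkstra_result_def)
  \<comment> \<open>A correct queue answers \<open>None\<close> only when it is empty, so every node
    of finite tentative distance has been processed.\<close>
  then have "queued_keys key \<sigma> = Map.empty"
    using pq assms(1) unfolding monotone_int_pq_def dijkstra_inv_def dijkstra_result_def
    by fastforce
  then have processed: "u \<in> set (order \<sigma>)" if "tent \<sigma> u = Some y" for u y
    using that by (auto simp: queued_keys_def fun_eq_iff split: if_splits)
  have edge: "\<exists>z. tent \<sigma> t = Some z \<and> z \<le> y + len (u, t)"
    if "tent \<sigma> u = Some y" "(u, t) \<in> parcs G" for u t y
    using inv processed[OF that(1)] that unfolding dijkstra_inv_def by fastforce
  \<comment> \<open>The edge inequalities telescope along the walk; the start \<open>u\<close> is
    arbitrary so that the induction can advance past the first edge.\<close>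
  have walk: "\<exists>z. tent \<sigma> t = Some z \<and> z \<le> y + awalk_cost len p"
    if "awalk u p t" "tent \<sigma> u = Some y" for u p t y
    using that
  proof (induction p arbitrary: u y)
    case Nil
    then show ?case by (simp add: awalk_Nil_iff)
  next
    case (Cons e p)
    then have e: "(u, snd e) \<in> parcs G" "fst e = u" and p: "awalk (snd e) p t"
      by (auto simp: awalk_Cons_iff)
    obtain y' where y': "tent \<sigma> (snd e) = Some y'" "y' \<le> y + len e"
      using edge[OF Cons.prems(2) e(1)] e(2) by (metis prod.collapse)
    then show ?case using Cons.IH[OF p y'(1)] by force
  qed
  obtain y where y: "tent \<sigma> w = Some y"
    using inv assms(2) unfolding dijkstra_inv_def by blast
  then obtain p where p: "awalk s p w" "awalk_cost len p = y"
    using inv unfolding dijkstra_inv_def by blast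
  obtain y\<^sub>0 where y\<^sub>0: "tent \<sigma> s = Some y\<^sub>0" "y\<^sub>0 \<le> 0"
    using inv unfolding dijkstra_inv_def by blast
  have "y \<le> awalk_cost len q" if "awalk s q w" for q
    using walk[OF that y\<^sub>0(1)] y y\<^sub>0(2) by auto
  then have "\<mu> len s w = ereal y"
    using p unfolding \<mu>_def by (intro antisym) (auto intro!: INF_lower2[of p] INF_greatest)
  then show ?thesis using y by (simp add: sp_dist_def)
qed

lemma dijkstra_result_label_dist:
  assumes "dijkstra_result H key G len s \<sigma>" "w \<in> set (order \<sigma>)"
  shows "label_dist \<sigma> w = ereal (the (tent \<sigma> w))"
proof -
  obtain l where "dijkstra_inv {e \<in> parcs G. fst e \<in> set (order \<sigma>)} l \<sigma>"
    using assms(1) dijkstra_reach_inv by (auto simp: dijkstra_result_def)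
  then show ?thesis
    using assms(2) unfolding dijkstra_inv_def label_dist_def by fastforce
qed

lemma dijkstra_result_sorted:
  assumes "dijkstra_result H key G len s \<sigma>"
  shows "sorted_wrt (\<lambda>v w. key (the (tent \<sigma> v)) \<le> key (the (tent \<sigma> w))) (order \<sigma>)"
  using assms dijkstra_reach_inv by (auto simp: dijkstra_result_def dijkstra_inv_def)

end

section \<open>From truncated keys to a \<delta>-PO\<close>

text \<open>Truncation loses less than one unit of \<delta>: \<open>x / \<delta> < \<lfloor>x /
  \<delta>\<rfloor> + 1 \<le> \<lfloor>y / \<delta>\<rfloor> + 1 \<le> y / \<delta> +
  1\<close>.\<close>

lemma less_add_if_floor_divide_le:
  fixes x y \<delta> :: real
  assumes "\<lfloor>x / \<delta>\<rfloor> \<le> \<lfloor>y / \<delta>\<rfloor>" "0 < \<delta>"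
  shows "x < y + \<delta>"
proof -
  have "x / \<delta> < y / \<delta> + 1"
    using assms(1) by linarith
  also have "\<dots> = (y + \<delta>) / \<delta>"
    using assms(2) by (simp add: add_divide_distrib)
  finally show ?thesis
    using assms(2) by (simp add: divide_less_cancel)
qed

theorem theorem2:
  fixes H :: "('v, 'h) int_pq"
    and G :: "'v pair_pre_digraph" and len :: "'v \<times> 'v \<Rightarrow> real" and s :: 'v and \<delta> :: real
    and \<sigma> :: "('v, real, 'h) dijkstra_state"
  assumes "monotone_int_pq H"
    and "\<And>(G' :: 'v pair_pre_digraph) (len' :: 'v \<times> 'v \<Rightarrow> int) s' \<delta>' \<sigma>'.
           P_SSSP G' len' s' \<delta>' \<Longrightarrow> dijkstra_result H (\<lambda>x. x) G' len' s' \<sigma>' \<Longrightarrow>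
           full_order (sp_dist G' (\<lambda>e. real_of_int (len' e)) s') (order \<sigma>')"
    and "P_SSSP G len s \<delta>"
    and "dijkstra_result H (\<lambda>x. \<lfloor>x / \<delta>\<rfloor>) G len s \<sigma>"
  shows "delta_PO \<delta> (sp_dist G len s) (order \<sigma>) \<and> delta_PO \<delta> (label_dist \<sigma>) (order \<sigma>)"
proof -
  have \<delta>: "0 < \<delta>"
    using assms(3) by (simp add: P_SSSP_def)
  interpret pair_fin_digraph G
    using assms(3) by (simp add: P_SSSP_def)
  have len_ge: "\<delta> \<le> len e" if "e \<in> parcs G" for e
    using assms(3) that by (simp add: P_SSSP_def)
  interpret keyed_dijkstra G H "\<lambda>x. \<lfloor>x / \<delta>\<rfloor>" len s
  proof
    show "mono (\<lambda>x. \<lfloor>x / \<delta>\<rfloor>)"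
      using \<delta> by (auto intro!: monoI floor_mono divide_right_mono)
    show "\<lfloor>x / \<delta>\<rfloor> < \<lfloor>(x + len e) / \<delta>\<rfloor>" if "e \<in> parcs G" for e x
    proof -
      \<comment> \<open>As \<delta> is the minimum edge length, an edge raises the quotient by at
        least 1, which always raises its floor.\<close>
      have "x / \<delta> + 1 \<le> (x + len e) / \<delta>"
        using len_ge[OF that] \<delta> by (simp add: field_simps)
      then show ?thesis by linarith
    qed
  qed (use assms in \<open>auto simp: P_SSSP_def\<close>)
  have "the (tent \<sigma> (order \<sigma> ! i)) < the (tent \<sigma> (order \<sigma> ! j)) + \<delta>"
    if "i < j" "j < length (order \<sigma>)" for i j
    using sorted_wrt_nth_less[OF dijkstra_result_sorted[OF assms(4)] that] \<delta>
    by (rule less_add_if_floor_divide_le)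
  \<comment> \<open>On processed nodes both distance functions equal the finite tentative distance,
    so the real inequality carries over to \<open>ereal\<close>.\<close>
  then show ?thesis
    using dijkstra_result_sp_dist[OF assms(4)] dijkstra_result_label_dist[OF assms(4)]
    by (simp add: delta_PO_def)
qed

end
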